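(* Let $a\in(1/15,\infty)$ and let $F_a(x)=\psi(x+1)-\mathcal{L}(x,a)$ for $x\in(0,\infty)$. Then $F_a$ is decreasing and convex on $(0,\infty)$ if and only if $a\in(1/15,a_0'']$, where $a_0''\approx 0.4321803644583305$.
   Context: $\psi(x)=\Gamma'(x)/\Gamma(x)$ ($x>0$) is the digamma (psi) function. For $x\ge0$ and $a>1/15$, $$\mathcal{L}(x,a)=\frac{1}{90a^{2}+2}\ln\left(x^{2}+x+\frac{3a+1}{3}\right)+\frac{45a^{2}}{90a^{2}+2}\ln\left(x^{2}+x+\frac{15a-1}{45a}\right),$$ and $\mathcal{L}_{xx}=\partial^2\mathcal{L}/\partial x^2$. The number $a_0''$ is the unique root on $(1/15,\infty)$ of the equation (in $a$) $\psi''(1)-\mathcal{L}_{xx}(0,a)=0$. *)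

theory Defs
  imports "HOL-Analysis.Analysis"
begin

text \<open>The digamma function \<open>\<psi>\<close> is the library's \<open>Digamma\<close>, which is defined by a series.\<close>

lemma Digamma_eq_deriv_Gamma_over_Gamma:
  fixes x :: real
  assumes "x > 0"
  shows "Digamma x = deriv Gamma x / Gamma x"
proof -
  have "(Gamma has_field_derivative Gamma x * Digamma x) (at x)"
    using assms by (intro has_field_derivative_Gamma) auto
  then have "deriv Gamma x = Gamma x * Digamma x"
    by (rule DERIV_imp_deriv)
  moreover have "Gamma x > 0"
    using assms by (rule Gamma_real_pos)
  ultimately show ?thesis by simp
qed

definition L :: "real \<Rightarrow> real \<Rightarrow> real" where
  "L x a = 1 / (90 * a\<^sup>2 + 2) * ln (x\<^sup>2 + x + (3 * a + 1) / 3)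
         + 45 * a\<^sup>2 / (90 * a\<^sup>2 + 2) * ln (x\<^sup>2 + x + (15 * a - 1) / (45 * a))"

text \<open>The formula for \<open>L x a\<close> is smooth in a two-sided neighbourhood of every \<open>x \<ge> 0\<close>
  when \<open>a > 1/15\<close>, so the ordinary derivative is also the right one at the endpoint \<open>x = 0\<close>.\<close>

definition L_xx :: "real \<Rightarrow> real \<Rightarrow> real" where
  "L_xx x a = (deriv ^^ 2) (\<lambda>t. L t a) x"

definition is_root :: "real \<Rightarrow> bool" where
  "is_root a \<longleftrightarrow> a \<in> {1/15<..} \<and> (deriv ^^ 2) Digamma 1 - L_xx 0 a = 0"

definition a0'' :: real where
  "a0'' = (THE a. is_root a)"

definition F :: "real \<Rightarrow> real \<Rightarrow> real" where
  "F a x = Digamma (x + 1) - L x a"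

end

theory Submission
  imports Defs "HOL-Real_Asymp.Real_Asymp"
begin

text \<open>
  Three moments of the two logarithms in \<open>L\<close> do not depend on \<open>a\<close>. As a consequence the second derivative
  \<open>L_xx x a\<close> is a rational function \<open>curv s t\<close> of \<open>t = x\<^sup>2 + x\<close> and of a single parameter
  \<open>s = 2/3 + a - 1/(45 a)\<close> that increases with \<open>a\<close>, and \<open>curv\<close> is strictly increasing in \<open>s\<close>
  (\<open>curv_strict_mono\<close>). So \<open>F_a'' x = \<psi>''(x + 1) - L_xx x a\<close> strictly decreases in \<open>a\<close> for each \<open>x \<ge> 0\<close>.

  At \<open>x = 0\<close> this yields the uniqueness of the root, and its location follows from the intermediate value
  theorem once \<open>\<psi>''(1) = -2 \<zeta>(3)\<close> is known to within \<open>4 / 10^17\<close> (\<open>Polygamma_2_1_bounds\<close>). It also yields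
  the necessity of \<open>a \<le> a0''\<close>: beyond \<open>a0''\<close> the second derivative is negative at \<open>0\<close>, so \<open>F_a\<close> is not convex to the
  right of \<open>0\<close>. For sufficiency it is enough to treat \<open>a = a0''\<close>, that is, to show that \<open>F_a''\<close> does not drop
  below its value \<open>0\<close> at the origin (\<open>curv_le_Polygamma_if_touching\<close>). For \<open>x \<ge> 1/100\<close> the difference
  equation \<open>\<psi>''(x + 2) = \<psi>''(x + 1) + 2/(x + 1)^3\<close> reduces this, by telescoping to infinity, to
  the positivity of a polynomial; for \<open>x \<le> 1/100\<close> the increments of \<open>\<psi>''\<close> and \<open>L_xx\<close> from \<open>0\<close> are compared.

  Convexity implies that \<open>F_a\<close> is decreasing, because \<open>F_a'\<close> then increases to its limit \<open>0\<close> at infinity.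
\<close>

section \<open>The derivatives of the logarithmic approximation\<close>

text \<open>Both logarithms in \<open>L\<close> depend on \<open>x\<close> only through \<open>t = x\<^sup>2 + x\<close>, and they are singular at
  \<open>t = -p\<close> and \<open>t = -q\<close> with \<open>p = a + 1/3\<close> and \<open>q = 1/3 - 1/(45 a)\<close>. This is \<open>p + q\<close>.\<close>

definition pole_sum :: "real \<Rightarrow> real" where
  "pole_sum a = 2/3 + a - 1 / (45 * a)"

text \<open>The weights \<open>A\<close>, \<open>B\<close> of the logarithms satisfy \<open>A + B = 1/2\<close>, \<open>A p + B q = 1/6\<close> and
  \<open>A p\<^sup>2 + B q\<^sup>2 = 1/15\<close> for every \<open>a\<close>. The recurrence \<open>1/15 = (p + q)/6 - p q/2\<close> between these moments
  makes \<open>p q\<close>, and hence \<open>(t + p)(t + q)\<close>, a function of \<open>s = p + q\<close> and \<open>t\<close> alone.\<close>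

definition pole_poly :: "real \<Rightarrow> real \<Rightarrow> real" where
  "pole_poly s t = t\<^sup>2 + s * t + s/3 - 2/15"

text \<open>The first and second \<open>x\<close>-derivatives of \<open>L\<close>, with \<open>a\<close> replaced by \<open>s = p + q\<close>. The numerator
  \<open>A (t + q) + B (t + p)\<close> of \<open>A/(t + p) + B/(t + q)\<close> is \<open>(t + s)/2 - 1/6\<close> by the same moment identities,
  and \<open>(2 x + 1)\<^sup>2 = 4 t + 1\<close> turns the second derivative into a function of \<open>t\<close>.\<close>

definition slope :: "real \<Rightarrow> real \<Rightarrow> real" where
  "slope s x = (2*x + 1) * ((x\<^sup>2 + x)/2 + s/2 - 1/6) / pole_poly s (x\<^sup>2 + x)"

definition curv :: "real \<Rightarrow> real \<Rightarrow> real" where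
  "curv s t = - (t^3 + (2 * s - 1/2) * t\<^sup>2 + (s\<^sup>2 - s/3 + 1/15) * t
      + (s\<^sup>2/6 - 4 * s/45 + 1/45)) / (pole_poly s t)\<^sup>2"

lemma pole_poly_factor:
  assumes "a > 1/15"
  shows "pole_poly (pole_sum a) t = (t + (3*a+1)/3) * (t + (15*a-1)/(45*a))"
  using assms by (simp add: pole_poly_def pole_sum_def field_simps power2_eq_square)

lemma pole_sum_mono: "0 < a \<Longrightarrow> a < b \<Longrightarrow> pole_sum a < pole_sum b"
  unfolding pole_sum_def by (smt (verit) frac_less2)

lemma pole_sum_gt: 
  assumes "a > 1/15" shows "pole_sum a > 2/5"
  using pole_sum_mono[of "1/15" a] assms by (simp add: pole_sum_def)

lemma pole_poly_pos:
  assumes "s > 2/5" "t \<ge> 0" shows "pole_poly s t > 0"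
  using assms mult_nonneg_nonneg[of s t] zero_le_power2[of t] unfolding pole_poly_def by linarith

lemma L_has_derivative:
  assumes a: "a > 1/15" and q: "x\<^sup>2 + x + (15*a-1)/(45*a) > 0"
  shows "((\<lambda>x. L x a) has_real_derivative slope (pole_sum a) x) (at x)"
proof -
  define P where "P = x\<^sup>2 + x + (3*a+1)/3"
  define Q where "Q = x\<^sup>2 + x + (15*a-1)/(45*a)"
  have "(x + 1/2)\<^sup>2 \<ge> 0" by simp
  then have P: "P > 0" using a unfolding P_def by (simp add: power2_eq_square field_simps)
  have Q: "Q > 0" using q by (simp add: Q_def)
  have A: "90 * a\<^sup>2 + 2 > 0" by (simp add: add_nonneg_pos)
  have "Q + 45 * a\<^sup>2 * P = (1 + 45 * a\<^sup>2) * (x\<^sup>2 + x + pole_sum a - 1/3)"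
    unfolding P_def Q_def pole_sum_def using a
    by (simp add: field_simps power2_eq_square)
  moreover have "1 + 45 * a\<^sup>2 \<noteq> 0" and M: "90 * a\<^sup>2 + 2 = 2 * (1 + 45 * a\<^sup>2)" using A by auto
  ultimately have "(Q + 45 * a\<^sup>2 * P) / (90 * a\<^sup>2 + 2) = (x\<^sup>2 + x + pole_sum a - 1/3) / 2"
    unfolding M by (simp del: distrib_left_numeral)
  then have *: "1 / (90 * a\<^sup>2 + 2) * Q + 45 * a\<^sup>2 / (90 * a\<^sup>2 + 2) * P
      = (x\<^sup>2 + x)/2 + pole_sum a/2 - 1/6"
    by (simp add: add_divide_distrib diff_divide_distrib)
  have combine: "\<alpha> * (u / P) + \<beta> * (u / Q) = u * (\<alpha> * Q + \<beta> * P) / (P * Q)" for \<alpha> \<beta> u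
    using P Q by (simp add: field_simps)
  have D: "((\<lambda>x. ln (x\<^sup>2 + x + c)) has_real_derivative (2*x+1) / (x\<^sup>2 + x + c)) (at x)"
    if "x\<^sup>2 + x + c > 0" for c
    using that by (auto intro!: derivative_eq_intros)
  have "((\<lambda>x. L x a) has_real_derivative
      1 / (90 * a\<^sup>2 + 2) * ((2*x+1) / P) + 45 * a\<^sup>2 / (90 * a\<^sup>2 + 2) * ((2*x+1) / Q)) (at x)"
    unfolding L_def P_def Q_def
    by (intro DERIV_add DERIV_cmult D) (use P Q in \<open>simp_all only: P_def Q_def\<close>)
  also have "1 / (90 * a\<^sup>2 + 2) * ((2*x+1) / P) + 45 * a\<^sup>2 / (90 * a\<^sup>2 + 2) * ((2*x+1) / Q)
      = (2*x+1) * (1 / (90 * a\<^sup>2 + 2) * Q + 45 * a\<^sup>2 / (90 * a\<^sup>2 + 2) * P) / (P * Q)"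
    by (rule combine)
  also have "\<dots> = slope (pole_sum a) x"
    unfolding * slope_def pole_poly_factor[OF a] by (simp add: P_def Q_def)
  finally show ?thesis .
qed

lemma slope_has_derivative:
  assumes "pole_poly s (x\<^sup>2 + x) \<noteq> 0"
  shows "(slope s has_real_derivative curv s (x\<^sup>2 + x)) (at x)"
proof -
  define d where "d = pole_poly s (x\<^sup>2 + x)"
  have d: "d \<noteq> 0" using assms by (simp add: d_def)
  have 1: "((\<lambda>x. pole_poly s (x\<^sup>2 + x)) has_real_derivative (2*(x\<^sup>2+x) + s) * (2*x+1)) (at x)"
    unfolding pole_poly_def by (auto intro!: derivative_eq_intros simp: algebra_simps)
  have 2: "((\<lambda>x. (2*x + 1) * ((x\<^sup>2 + x)/2 + s/2 - 1/6)) has_real_derivative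
     2 * ((x\<^sup>2 + x)/2 + s/2 - 1/6) + (2*x+1)\<^sup>2/2) (at x)"
    by (auto intro!: derivative_eq_intros simp: field_simps power2_eq_square)
  have "(slope s has_real_derivative
     ((2 * ((x\<^sup>2 + x)/2 + s/2 - 1/6) + (2*x+1)\<^sup>2/2) * d
      - (2*x + 1) * ((x\<^sup>2 + x)/2 + s/2 - 1/6) * ((2*(x\<^sup>2+x) + s) * (2*x+1))) / (d*d)) (at x)"
    unfolding slope_def[abs_def] d_def by (rule DERIV_divide[OF 2 1 assms])
  also have "(2 * ((x\<^sup>2 + x)/2 + s/2 - 1/6) + (2*x+1)\<^sup>2/2) * d
      - (2*x + 1) * ((x\<^sup>2 + x)/2 + s/2 - 1/6) * ((2*(x\<^sup>2+x) + s) * (2*x+1)) =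
     - ((x\<^sup>2+x)^3 + (2 * s - 1/2) * (x\<^sup>2+x)\<^sup>2 + (s\<^sup>2 - s/3 + 1/15) * (x\<^sup>2+x)
      + (s\<^sup>2/6 - 4 * s/45 + 1/45))"
    unfolding d_def pole_poly_def by (simp add: field_simps) algebra
  finally show ?thesis unfolding curv_def d_def by (simp add: power2_eq_square)
qed

text \<open>Passing from \<open>r\<close> to \<open>s\<close> changes \<open>((t + s)/2 - 1/6) / pole_poly s t\<close> by exactly
  \<open>- (s - r) / (90 pole_poly r t pole_poly s t)\<close>. The identity in the proof is what this becomes after one more
  differentiation in \<open>x\<close>; it is positive because \<open>pole_poly\<close> is dominated by \<open>4 t + 1\<close> times its
  \<open>t\<close>-derivative.\<close>

lemma curv_strict_mono:
  assumes "2/5 < r" "r < s" "t \<ge> 0"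
  shows "curv r t < curv s t"
proof -
  define N where "N = (\<lambda>s. - (t^3 + (2 * s - 1/2) * t\<^sup>2 + (s\<^sup>2 - s/3 + 1/15) * t
      + (s\<^sup>2/6 - 4 * s/45 + 1/45)))"
  define d where "d = (\<lambda>s. pole_poly s t)"
  have d: "d r > 0" "d s > 0" using assms pole_poly_pos by (auto simp: d_def)
  have id: "N s * (d r)\<^sup>2 - N r * (d s)\<^sup>2 = (s - r) / 90 *
     (((4*t+1)*(2*t+r) - d r) * d s + ((4*t+1)*(2*t+s) - d s) * d r)"
    unfolding N_def d_def pole_poly_def by (simp add: field_simps) algebra
  have pos: "(4*t+1)*(2*t+u) - d u > 0" if "u > 2/5" for u
  proof -
    have "(4*t+1)*(2*t+u) - d u = 7*t\<^sup>2 + 3*(u*t) + 2*t + 2*u/3 + 2/15"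
      unfolding d_def pole_poly_def by (simp add: algebra_simps power2_eq_square)
    then show ?thesis using that assms(3) mult_nonneg_nonneg[of u t] zero_le_power2[of t] by linarith
  qed
  have "N s * (d r)\<^sup>2 - N r * (d s)\<^sup>2 > 0"
    unfolding id using assms d pos[of r] pos[of s]
    by (intro mult_pos_pos add_pos_pos) auto
  then have "N r / (d r)\<^sup>2 < N s / (d s)\<^sup>2" using d by (simp add: field_simps)
  then show ?thesis by (simp add: curv_def N_def d_def)
qed

lemma pole_shift_pos: "a > 1/15 \<Longrightarrow> (15*a-1)/(45*a) > (0::real)"
  by simp

text \<open>For \<open>x = 0\<close> the iterated derivative needs the formula for the first derivative on a two-sided
  neighbourhood, where \<open>x\<^sup>2 + x\<close> may be negative; the open set in the proof provides one.\<close>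

lemma L_xx_eq:
  assumes a: "a > 1/15" and x: "x \<ge> 0"
  shows "L_xx x a = curv (pole_sum a) (x\<^sup>2 + x)"
proof -
  let ?U = "{x. x\<^sup>2 + x + (15*a-1)/(45*a) > 0}"
  have "open ?U" by (intro open_Collect_less continuous_intros)
  moreover have "x \<in> ?U" using pole_shift_pos[OF a] x by (auto intro: add_nonneg_pos)
  ultimately have "\<forall>\<^sub>F y in nhds x. y \<in> ?U" by (rule eventually_nhds_in_open)
  then have "\<forall>\<^sub>F y in nhds x. deriv (\<lambda>t. L t a) y = slope (pole_sum a) y"
    by eventually_elim (use L_has_derivative[OF a] in \<open>auto intro: DERIV_imp_deriv\<close>)
  then have "deriv (deriv (\<lambda>t. L t a)) x = deriv (slope (pole_sum a)) x"
    by (intro deriv_cong_ev) auto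
  also have "\<dots> = curv (pole_sum a) (x\<^sup>2 + x)"
  proof (intro DERIV_imp_deriv slope_has_derivative)
    show "pole_poly (pole_sum a) (x\<^sup>2 + x) \<noteq> 0"
      using pole_poly_pos[OF pole_sum_gt[OF a], of "x\<^sup>2 + x"] x by simp
  qed
  finally show ?thesis by (simp add: L_xx_def numeral_2_eq_2)
qed

section \<open>Difference equation and bounds for polygamma functions\<close>

text \<open>Polygamma functions of order at least one satisfy a first-order difference equation and vanish at
  infinity. An inequality between them and rational functions is therefore reduced by this lemma to an
  inequality between rational functions.\<close>

lemma nonneg_if_antimono_tendsto_zero:
  fixes h :: "real \<Rightarrow> real"
  assumes "\<And>n. h (x + real n + 1) \<le> h (x + real n)"
    and "(\<lambda>n. h (x + real n)) \<longlonglongrightarrow> 0"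
  shows "h x \<ge> 0"
proof -
  have "decseq (\<lambda>n. h (x + real n))"
    by (rule decseq_SucI) (use assms(1) in \<open>simp add: add_ac\<close>)
  from decseq_ge[OF this assms(2), of 0] show ?thesis by simp
qed

lemma Polygamma_add_nat_tendsto_zero:
  fixes y :: real
  assumes "y > 0" "m > 0"
  shows "(\<lambda>n. Polygamma m (y + real n)) \<longlonglongrightarrow> 0"
proof -
  define S where "S = (-1) ^ Suc m * Polygamma m y / fact m"
  have "(\<lambda>k. inverse ((y + of_nat k)^Suc m)) sums S"
    unfolding S_def by (rule Polygamma_LIMSEQ) (use assms in auto)
  then have "(\<lambda>n. \<Sum>k<n. inverse ((y + of_nat k)^Suc m)) \<longlonglongrightarrow> S"
    by (simp add: sums_def)
  then have "(\<lambda>n. Polygamma m y + (-1)^m * fact m * (\<Sum>k<n. 1 / (y + of_nat k)^Suc m)) \<longlonglongrightarrow>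
      Polygamma m y + (-1)^m * fact m * S"
    by (intro tendsto_intros) (simp add: inverse_eq_divide)
  also have "Polygamma m y + (-1)^m * fact m * S = 0"
    by (simp add: S_def flip: power_mult_distrib)
  also have "(\<lambda>n. Polygamma m y + (-1)^m * fact m * (\<Sum>k<n. 1 / (y + of_nat k)^Suc m)) =
      (\<lambda>n. Polygamma m (y + real n))"
    using assms by (intro ext, subst Polygamma_plus_of_nat) (auto simp: eq_neg_iff_add_eq_0)
  finally show ?thesis .
qed

lemma Polygamma_2_plus1:
  fixes y :: real
  assumes "y > 0"
  shows "Polygamma 2 (y + 1) = Polygamma 2 y + 2 / y^3"
  using Polygamma_plus1[of y 2] assms by (simp add: fact_numeral power3_eq_cube)

lemma Polygamma_2_mono:
  fixes x y :: real
  assumes "0 < x" "x \<le> y"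
  shows "Polygamma 2 x \<le> Polygamma 2 y"
proof -
  have *: "(\<lambda>k. inverse ((z + of_nat k)^3)) sums (- Polygamma 2 z / 2)" if "z > 0" for z :: real
    using Polygamma_LIMSEQ[of z 2] that by (simp add: eval_nat_numeral)
  have "- Polygamma 2 y / 2 \<le> - Polygamma 2 x / 2"
    by (rule sums_le[OF _ *[of y] *[of x]])
       (use assms in \<open>auto intro!: le_imp_inverse_le power_mono add_mono zero_less_power add_pos_nonneg\<close>)
  then show ?thesis by simp
qed

lemma shifted_at_top: "filterlim (\<lambda>n. x + real n) at_top sequentially"
  by real_asymp

text \<open>The bounds here and in the next lemma are truncations of the Euler-Maclaurin expansion of
  \<open>\<Sum>k. 1 / (y + k)^3\<close>. The defect of each truncation, taken between \<open>y\<close> and \<open>y + 1\<close>, has a numerator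
  whose coefficients are all of one sign.\<close>

lemma Polygamma_2_upper:
  fixes y :: real
  assumes "y > 0"
  shows "Polygamma 2 y \<le> - 2 * (1/(2*y^2) + 1/(2*y^3) + 1/(4*y^4) - 1/(12*y^6))"
proof -
  define E where "E = (\<lambda>y::real. 1/(2*y^2) + 1/(2*y^3) + 1/(4*y^4) - 1/(12*y^6))"
  define h where "h = (\<lambda>y. - 2 * E y - Polygamma 2 y)"
  have step: "h (z + 1) \<le> h z" if "z > 0" for z
  proof -
    have "E z - E (z+1) - 1/z^3 = - ((1 + 2*z)^3 / (12 * z^6 * (z+1)^6))"
      using that unfolding E_def by (simp add: divide_simps) algebra
    also have "\<dots> \<le> 0" using that by simp
    finally show ?thesis unfolding h_def using Polygamma_2_plus1[OF that] by simp
  qed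
  have "(E \<longlongrightarrow> 0) at_top" unfolding E_def by real_asymp
  from filterlim_compose[OF this shifted_at_top[of y]]
  have "(\<lambda>n. h (y + real n)) \<longlonglongrightarrow> - 2 * 0 - 0"
    unfolding h_def using assms by (intro tendsto_intros Polygamma_add_nat_tendsto_zero) auto
  then have "h y \<ge> 0"
    using assms by (intro nonneg_if_antimono_tendsto_zero step) auto
  then show ?thesis by (simp add: h_def E_def)
qed

lemma Polygamma_2_lower:
  fixes y :: real
  assumes "y > 0"
  shows "Polygamma 2 y \<ge> - 2 * (1/(2*y^2) + 1/(2*y^3) + 1/(4*y^4) - 1/(12*y^6) + 1/(12*y^8))"
proof -
  define E where "E = (\<lambda>y::real. 1/(2*y^2) + 1/(2*y^3) + 1/(4*y^4) - 1/(12*y^6) + 1/(12*y^8))"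
  define h where "h = (\<lambda>y. Polygamma 2 y + 2 * E y)"
  have step: "h (z + 1) \<le> h z" if "z > 0" for z
  proof -
    have "E z - E (z+1) - 1/z^3 =
        (1 + 8*z + 27*z^2 + 48*z^3 + 45*z^4 + 18*z^5) / (12 * z^8 * (z+1)^8)"
      using that unfolding E_def by (simp add: divide_simps) algebra
    also have "\<dots> \<ge> 0" using that by simp
    finally show ?thesis unfolding h_def using Polygamma_2_plus1[OF that] by simp
  qed
  have "(E \<longlongrightarrow> 0) at_top" unfolding E_def by real_asymp
  from filterlim_compose[OF this shifted_at_top[of y]]
  have "(\<lambda>n. h (y + real n)) \<longlonglongrightarrow> 0 + 2 * 0"
    unfolding h_def using assms by (intro tendsto_intros Polygamma_add_nat_tendsto_zero) auto
  then have "h y \<ge> 0"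
    using assms by (intro nonneg_if_antimono_tendsto_zero step) auto
  then show ?thesis by (simp add: h_def E_def)
qed

section \<open>The second derivative at the critical parameter\<close>

lemma curv_tendsto_zero: "((\<lambda>x. curv s (x\<^sup>2 + x)) \<longlongrightarrow> 0) at_top"
  unfolding curv_def pole_poly_def by real_asymp

lemma slope_tendsto_zero: "(slope s \<longlongrightarrow> 0) at_top"
  unfolding slope_def[abs_def] pole_poly_def by real_asymp

text \<open>With \<open>v = x + 1\<close>, the arguments \<open>v\<^sup>2 + v\<close> and \<open>v\<^sup>2 - v\<close> are the values of \<open>t\<close> at \<open>x + 1\<close> and \<open>x\<close>, and
  they are exchanged by \<open>v \<mapsto> -v\<close>. After clearing denominators the difference is therefore a polynomial in
  \<open>v\<^sup>2\<close>. The matched moments cancel its top terms down to degree five, and expanded at \<open>v\<^sup>2 = 51/50\<close>, just below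
  \<open>(101/100)\<^sup>2\<close>, its coefficients are positive. The parameter \<open>21/20\<close> is a simple number above the critical
  value \<open>pole_sum a0'' \<approx> 1.04743\<close>.\<close>

lemma curv_step_bound:
  fixes v :: real
  assumes "v \<ge> 101/100"
  shows "curv (21/20) (v\<^sup>2 + v) - curv (21/20) (v\<^sup>2 - v) \<ge> 2 / v^3"
proof -
  define N where "N = (\<lambda>t::real. - (t^3 + 8/5 * t\<^sup>2 + 983/1200 * t + 811/7200))"
  define d where "d = pole_poly (21/20)"
  have curv: "curv (21/20) t = N t / (d t)\<^sup>2" for t
    unfolding curv_def N_def d_def by (simp add: power2_eq_square)
  have d: "d t = t\<^sup>2 + 21/20 * t + 13/60" for t by (simp add: d_def pole_poly_def)
  have v: "v > 0" using assms by simp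
  have "101/100 * (101/100) \<le> v * v" using assms by (intro mult_mono) auto
  then have vv: "v\<^sup>2 - 51/50 \<ge> 0" by (simp add: power2_eq_square)
  have pos: "d (v\<^sup>2 + v) > 0" "d (v\<^sup>2 - v) > 0"
    using assms mult_mono[of 1 v 1 v] unfolding d_def by (auto intro!: pole_poly_pos simp: power2_eq_square)
  define u where "u = v\<^sup>2 - 51/50"
  have "(N (v\<^sup>2 + v) * (d (v\<^sup>2 - v))\<^sup>2 - N (v\<^sup>2 - v) * (d (v\<^sup>2 + v))\<^sup>2) * v^3
        - 2 * (d (v\<^sup>2 + v))\<^sup>2 * (d (v\<^sup>2 - v))\<^sup>2
      = 20164545329/10125000000000 + 4377661121/6750000000 * u + 632020987/270000000 * u^2
        + 862751/270000 * u^3 + 17717/9000 * u^4 + 106/225 * u^5"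
    unfolding N_def d u_def by (simp add: field_simps) algebra
  also have "\<dots> \<ge> 0" using vv by (simp add: u_def)
  finally have "2 * ((d (v\<^sup>2 + v))\<^sup>2 * (d (v\<^sup>2 - v))\<^sup>2)
     \<le> (N (v\<^sup>2 + v) * (d (v\<^sup>2 - v))\<^sup>2 - N (v\<^sup>2 - v) * (d (v\<^sup>2 + v))\<^sup>2) * v^3" by simp
  then have "2 / v^3 \<le> (N (v\<^sup>2 + v) * (d (v\<^sup>2 - v))\<^sup>2 - N (v\<^sup>2 - v) * (d (v\<^sup>2 + v))\<^sup>2) /
     ((d (v\<^sup>2 + v))\<^sup>2 * (d (v\<^sup>2 - v))\<^sup>2)"
    using v pos by (simp add: divide_simps)
  also have "\<dots> = N (v\<^sup>2 + v) / (d (v\<^sup>2 + v))\<^sup>2 - N (v\<^sup>2 - v) / (d (v\<^sup>2 - v))\<^sup>2"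
    using pos by (simp add: diff_frac_eq)
  finally show ?thesis by (simp add: curv)
qed

lemma curv_le_Polygamma_away_from_zero:
  assumes "x \<ge> 1/100"
  shows "curv (21/20) (x\<^sup>2 + x) \<le> Polygamma 2 (x + 1)"
proof -
  define h where "h = (\<lambda>x. Polygamma 2 (x + 1) - curv (21/20) (x\<^sup>2 + x))"
  have step: "h (z + 1) \<le> h z" if "z \<ge> 1/100" for z
  proof -
    have eq: "(z + 1)\<^sup>2 - (z + 1) = z\<^sup>2 + z" by (simp add: power2_eq_square algebra_simps)
    have "101/100 \<le> z + 1" using that by simp
    from curv_step_bound[OF this, unfolded eq] Polygamma_2_plus1[of "z + 1"] that
    show ?thesis unfolding h_def by linarith
  qed
  have "(\<lambda>n. Polygamma 2 ((x + 1) + real n)) \<longlonglongrightarrow> 0"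
    using assms by (intro Polygamma_add_nat_tendsto_zero) auto
  moreover have "(\<lambda>n. curv (21/20) ((x + real n)\<^sup>2 + (x + real n))) \<longlonglongrightarrow> 0"
    by (rule filterlim_compose[OF curv_tendsto_zero shifted_at_top])
  ultimately have "(\<lambda>n. h (x + real n)) \<longlonglongrightarrow> 0 - 0"
    unfolding h_def by (intro tendsto_diff) (simp_all add: add_ac)
  then have "h x \<ge> 0"
    using assms by (intro nonneg_if_antimono_tendsto_zero step) auto
  then show ?thesis by (simp add: h_def)
qed

text \<open>At the critical parameter, \<open>\<psi>''(x + 1)\<close> and \<open>L_xx\<close> agree at \<open>x = 0\<close>, so near zero their
  increments are compared instead. The difference quotient of \<open>curv\<close> is about \<open>5.85\<close> there, that of
  \<open>\<psi>''\<close> is at least \<open>25/4\<close> in \<open>x\<close>; the constant \<open>618/100\<close> lies between them and leaves room for the factor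
  \<open>1 + x \<le> 101/100\<close> between \<open>t\<close> and \<open>x\<close>.\<close>

lemma curv_increment_near_zero:
  assumes s: "s \<in> {10474/10000..10475/10000}" and t: "0 \<le> t" "t \<le> 101/10000"
  shows "curv s t - curv s 0 \<le> 618/100 * t"
proof -
  define c where "c = s/3 - 2/15"
  define K where "K = s\<^sup>2/6 - 4 * s/45 + 1/45"
  define N where "N = t^3 + (2 * s - 1/2) * t\<^sup>2 + (s\<^sup>2 - s/3 + 1/15) * t + K"
  define d where "d = pole_poly s t"
  define A where "A = 2 * s * c * K - (s\<^sup>2 - s/3 + 1/15) * c\<^sup>2"
  define B where "B = K * (s\<^sup>2 + 2*c) - (2 * s - 1/2) * c\<^sup>2"
  define C where "C = 2 * s * K - c\<^sup>2"
  have d: "d = c + s * t + t\<^sup>2" by (simp add: d_def c_def pole_poly_def)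
  have "10474/10000 * (10474/10000) \<le> s * s" "s * s \<le> 10475/10000 * (10475/10000)"
    using s by (intro mult_mono; auto)+
  then have ss: "1.09704 \<le> s\<^sup>2" "s\<^sup>2 \<le> 1.09726" by (simp_all add: power2_eq_square)
  have cb: "0.2158 \<le> c" "c \<le> 0.21584" using s unfolding c_def by auto
  have Kb: "0.1119 \<le> K" "K \<le> 0.1121" using s ss unfolding K_def by auto
  have "0.2158 * 0.2158 \<le> c * c" "c * c \<le> 0.21584 * 0.21584"
    using cb by (intro mult_mono; auto)+
  then have cc: "0.04656 \<le> c\<^sup>2" "c\<^sup>2 \<le> 0.046587" by (simp_all add: power2_eq_square)
  have c4: "c^4 \<ge> 13/6000"
  proof -
    have "0.04656 * 0.04656 \<le> c\<^sup>2 * c\<^sup>2" using cc by (intro mult_mono) auto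
    also have "c\<^sup>2 * c\<^sup>2 = c^4" by (simp flip: power_add)
    finally show ?thesis by simp
  qed
  have sc: "s * c \<le> 1.0475 * 0.21584" "0.226 \<le> s * c"
  proof -
    show "s * c \<le> 1.0475 * 0.21584" using s cb by (intro mult_mono) auto
    have "1.0474 * 0.2158 \<le> s * c" using s cb by (intro mult_mono) auto
    then show "0.226 \<le> s * c" by simp
  qed
  have A: "A \<le> 0.0134 - 0.0003"
  proof -
    have "s * c * K \<le> (1.0475 * 0.21584) * 0.1121" using s cb Kb sc by (intro mult_mono) auto
    moreover have "0.8145 * 0.04656 \<le> (s\<^sup>2 - s/3 + 1/15) * c\<^sup>2"
      using s ss cc by (intro mult_mono) auto
    ultimately show ?thesis unfolding A_def by simp
  qed
  have B: "B \<le> 0.1"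
  proof -
    have "K * (s\<^sup>2 + 2*c) \<le> 0.1121 * 1.53" using Kb ss cb by (intro mult_mono) auto
    moreover have "1.59 * 0.04656 \<le> (2 * s - 1/2) * c\<^sup>2"
      using s cc by (intro mult_mono) auto
    ultimately show ?thesis unfolding B_def by simp
  qed
  have C: "C \<le> 0.2"
  proof -
    have "s * K \<le> 1.0475 * 0.1121" using s Kb by (intro mult_mono) auto
    then show ?thesis unfolding C_def using cc by simp
  qed
  have c3s: "2 * c\<^sup>2 * (s * c) \<ge> 21/1000"
  proof -
    have "0.04656 * 0.226 \<le> c\<^sup>2 * (s * c)" using cc sc by (intro mult_mono) auto
    then show ?thesis by simp
  qed
  have "t * t \<le> 0.0101 * t" using t by (intro mult_right_mono) auto
  then have tt: "t\<^sup>2 \<le> 0.0101 * t" by (simp add: power2_eq_square)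
  have t3: "t^3 \<le> 0.0101 * t"
  proof -
    have "t^3 = t\<^sup>2 * t" by (simp add: eval_nat_numeral)
    also have "\<dots> \<le> t\<^sup>2 * 1" using t by (intro mult_left_mono) auto
    finally show ?thesis using tt by simp
  qed
  \<comment> \<open>The constant terms cancel, which is where the factor \<open>t\<close> comes from.\<close>
  have "K * d\<^sup>2 - c\<^sup>2 * N = t * (A + B * t + C * t\<^sup>2 + K * t^3)"
    unfolding A_def B_def C_def N_def d by algebra
  also have "\<dots> \<le> t * (618/100 * (c\<^sup>2 * d\<^sup>2))"
  proof (rule mult_left_mono[OF _ t(1)])
    have "B * t \<le> 0.1 * t" "C * t\<^sup>2 \<le> 0.2 * t\<^sup>2" "K * t^3 \<le> 0.1121 * t^3"
      using mult_right_mono[OF B t(1)] mult_right_mono[OF C, of "t\<^sup>2"]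
        mult_right_mono[OF Kb(2), of "t^3"] t by simp_all
    then have "A + B * t + C * t\<^sup>2 + K * t^3 \<le> 131/10000 + 11/100 * t" using A tt t3 t by simp
    also have "\<dots> \<le> 618/100 * c^4 + 618/100 * (2 * c\<^sup>2 * (s * c)) * t"
      using c4 t mult_right_mono[OF c3s t(1)] by linarith
    \<comment> \<open>The quadratic part of \<open>d\<^sup>2\<close> in \<open>t\<close> may be dropped, but not the linear one: it offsets \<open>B * t\<close>.\<close>
    also have "\<dots> = 618/100 * (c\<^sup>2 * (c\<^sup>2 + 2 * (c * (s * t))))"
      by (simp add: algebra_simps eval_nat_numeral)
    also have "\<dots> \<le> 618/100 * (c\<^sup>2 * d\<^sup>2)"
    proof -
      have "c\<^sup>2 + 2 * (c * (s * t)) \<le> (c + s * t)\<^sup>2" by (simp add: power2_sum)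
      also have "\<dots> \<le> d\<^sup>2" unfolding d using s cb t by (intro power_mono) auto
      finally show ?thesis by (intro mult_left_mono) auto
    qed
    finally show "A + B * t + C * t\<^sup>2 + K * t^3 \<le> 618/100 * (c\<^sup>2 * d\<^sup>2)" .
  qed
  finally have main: "K * d\<^sup>2 - c\<^sup>2 * N \<le> 618/100 * t * (c\<^sup>2 * d\<^sup>2)" by (simp add: mult_ac)
  have "c > 0" "d > 0" using cb s t unfolding d by (auto intro!: add_pos_nonneg)
  have "curv s t = - (N / d\<^sup>2)" unfolding curv_def N_def K_def d_def by (rule minus_divide_left[symmetric])
  moreover have "curv s 0 = - (K / c\<^sup>2)"
    unfolding curv_def K_def c_def pole_poly_def by (simp only: minus_divide_left) simp
  ultimately have "curv s t - curv s 0 = K / c\<^sup>2 - N / d\<^sup>2" by simp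
  also have "\<dots> = (K * d\<^sup>2 - c\<^sup>2 * N) / (c\<^sup>2 * d\<^sup>2)"
    using \<open>c > 0\<close> \<open>d > 0\<close> by (simp add: diff_frac_eq mult_ac)
  also have "\<dots> \<le> 618/100 * t"
    using main \<open>c > 0\<close> \<open>d > 0\<close> by (simp add: pos_divide_le_eq)
  finally show ?thesis .
qed

text \<open>The first two terms of \<open>\<psi>''(x + 1) - \<psi>''(1) = 2 (\<Sum>k. 1/(1 + k)^3 - 1/(1 + k + x)^3)\<close> suffice; they
  have slopes \<open>6\<close> and \<open>3/8\<close> at zero.\<close>

lemma Polygamma_2_increment_near_zero:
  fixes x :: real
  assumes "0 \<le> x" "x \<le> 1/100"
  shows "Polygamma 2 (x + 1) - Polygamma 2 1 \<ge> 25/4 * x"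
proof -
  have cube: "1 - 1 / (1 + z)^3 \<ge> 3 * z - 6 * z\<^sup>2" if "z \<ge> 0" for z :: real
  proof -
    have "(1 - 3*z + 6*z\<^sup>2) * (1 + z)^3 = 1 + 10*z^3 + 15*z^4 + 6*z^5"
      by algebra
    also have "\<dots> \<ge> 1" using that by simp
    finally have "1 / (1+z)^3 \<le> 1 - 3*z + 6*z\<^sup>2" using that by (simp add: pos_divide_le_eq)
    then show ?thesis by simp
  qed
  have "(x + 2)^3 = 8 * (1 + x/2)^3" by (simp add: field_simps eval_nat_numeral)
  then have two: "1/8 - 1/(x + 2)^3 = (1 - 1/(1 + x/2)^3) / 8" by (simp add: field_simps)
  have xx: "x\<^sup>2 \<le> x / 100" using assms mult_right_mono[of x "1/100" x] by (simp add: power2_eq_square)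
  have shifts: "x + 1 + 1 = x + 2" "x + 2 + 1 = x + 3" by simp_all
  have "Polygamma 2 (x + 1) = Polygamma 2 (x + 3) - 2 / (x + 1)^3 - 2 / (x + 2)^3"
    using Polygamma_2_plus1[of "x + 1"] Polygamma_2_plus1[of "x + 2"] assms
    unfolding shifts by simp
  moreover have "Polygamma 2 (1::real) = Polygamma 2 3 - 2 - 2 / 8"
    using Polygamma_2_plus1[of 1] Polygamma_2_plus1[of 2] by simp
  moreover have "Polygamma 2 3 \<le> Polygamma 2 (x + 3)"
    using assms by (intro Polygamma_2_mono) auto
  ultimately have "Polygamma 2 (x + 1) - Polygamma 2 1 \<ge> 2 * (1 - 1/(x + 1)^3) + 2 * (1/8 - 1/(x + 2)^3)"
    by simp
  moreover have "2 * p + 2 * (q / 8) \<ge> 25/4 * x"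
    if "p \<ge> 3 * x - 6 * x\<^sup>2" "q \<ge> 3/2 * x - 3/2 * x\<^sup>2" for p q :: real
    using that xx assms by linarith
  from this[of "1 - 1/(x + 1)^3" "1 - 1/(1 + x/2)^3"]
  have "2 * (1 - 1/(x + 1)^3) + 2 * ((1 - 1/(1 + x/2)^3) / 8) \<ge> 25/4 * x"
    using cube[of x] cube[of "x/2"] assms by (simp add: add.commute power_divide)
  ultimately show ?thesis unfolding two by linarith
qed

text \<open>The hypothesis \<open>root\<close> says that \<open>F\<close> has vanishing second derivative at \<open>0\<close>. Near \<open>0\<close> the second
  derivative is nonnegative because it grows from this zero; away from \<open>0\<close> there is enough room to raise
  the parameter to \<open>21/20\<close>, which allows a telescoping argument with explicit numbers. The telescoping argument
  cannot reach \<open>0\<close>, where the single steps have the wrong sign.\<close>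

lemma curv_le_Polygamma_if_touching:
  assumes s: "s \<in> {10474/10000..10475/10000}" and root: "Polygamma 2 1 = curv s 0"
    and x: "x \<ge> 0"
  shows "curv s (x\<^sup>2 + x) \<le> Polygamma 2 (x + 1)"
proof (cases "x \<le> 1/100")
  case True
  then have "x * x \<le> 1/100 * x" using x by (intro mult_right_mono) auto
  then have t: "x\<^sup>2 + x \<le> 1.01 * x" by (simp add: power2_eq_square)
  have "curv s (x\<^sup>2 + x) - curv s 0 \<le> 618/100 * (x\<^sup>2 + x)"
    using True x t by (intro curv_increment_near_zero s) auto
  also have "\<dots> \<le> 25/4 * x" using t x by simp
  also have "\<dots> \<le> Polygamma 2 (x + 1) - Polygamma 2 1"
    using True x by (intro Polygamma_2_increment_near_zero)
  finally show ?thesis using root by simp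
next
  case False
  have "curv s (x\<^sup>2 + x) < curv (21/20) (x\<^sup>2 + x)"
    using s x by (intro curv_strict_mono) auto
  also have "\<dots> \<le> Polygamma 2 (x + 1)"
    using False by (intro curv_le_Polygamma_away_from_zero) simp
  finally show ?thesis by simp
qed

section \<open>The critical parameter\<close>

lemma Polygamma_2_1_shift:
  "Polygamma 2 (1::real) = Polygamma 2 101 - 2 * (\<Sum>k<100. 1 / (1 + real k)^3)"
proof -
  have "\<forall>k<100. (1::real) \<noteq> - of_nat k" by (auto simp: eq_neg_iff_add_eq_0)
  from Polygamma_plus_of_nat[OF this, of 2] show ?thesis by (simp add: fact_numeral)
qed

text \<open>This is \<open>\<psi>''(1) = -2 \<zeta>(3)\<close>. The Euler-Maclaurin bounds at \<open>101\<close> differ by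
  \<open>1 / (6 * 101^8) < 2 / 10^17\<close>, which is fine enough to locate the root to within \<open>1 / 10^16\<close>.\<close>

lemma Polygamma_2_1_bounds:
  "Polygamma 2 (1::real) \<in> {-2.40411380631918859<..<-2.40411380631918855}"
proof -
  define E6 :: real where "E6 = 1/(2*101^2) + 1/(2*101^3) + 1/(4*101^4) - 1/(12*101^6)"
  define E8 :: real where "E8 = E6 + 1/(12*101^8)"
  have "(\<Sum>k<100. 1 / (1 + real k)^3) \<in> {2.40411380631918855/2 - E6<..<2.40411380631918859/2 - E8}"
    by (simp add: lessThan_nat_numeral lessThan_Suc E6_def E8_def)
  then show ?thesis
    using Polygamma_2_lower[of 101] Polygamma_2_upper[of 101] Polygamma_2_1_shift
    unfolding E6_def E8_def by simp
qed

lemma Polygamma_2_1_between: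
  "curv (pole_sum 0.4321803644583304) 0 < Polygamma 2 (1::real)"
  "Polygamma 2 (1::real) < curv (pole_sum 0.4321803644583306) 0"
proof -
  have "curv (pole_sum 0.4321803644583304) 0 < -2.40411380631918859"
    "-2.40411380631918855 < curv (pole_sum 0.4321803644583306) 0"
    by (simp_all add: curv_def pole_sum_def pole_poly_def power2_eq_square)
  with Polygamma_2_1_bounds
  show "curv (pole_sum 0.4321803644583304) 0 < Polygamma 2 (1::real)"
    "Polygamma 2 (1::real) < curv (pole_sum 0.4321803644583306) 0" by auto
qed

lemma is_root_iff: "is_root a \<longleftrightarrow> a > 1/15 \<and> Polygamma 2 1 = curv (pole_sum a) 0"
proof -
  have "(deriv ^^ 2) Digamma (1::real) = Polygamma 2 1"
    by (subst higher_deriv_Polygamma) (auto simp: numeral_2_eq_2)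
  then show ?thesis unfolding is_root_def using L_xx_eq[of a 0] by auto
qed

lemma curv_pole_sum_strict_mono:
  assumes "1/15 < a" "a < b" "t \<ge> 0"
  shows "curv (pole_sum a) t < curv (pole_sum b) t"
  using assms pole_sum_gt pole_sum_mono by (intro curv_strict_mono) auto

lemma root_unique: "is_root a \<Longrightarrow> is_root b \<Longrightarrow> a = b"
  using curv_pole_sum_strict_mono[of a b 0] curv_pole_sum_strict_mono[of b a 0]
  unfolding is_root_iff by (cases a b rule: linorder_cases) auto

lemma root_exists:
  obtains a where "is_root a" "0.4321803644583304 < a" "a < 0.4321803644583306"
proof -
  let ?l = "0.4321803644583304 :: real" and ?u = "0.4321803644583306 :: real"
  have "continuous_on {?l..?u} (\<lambda>a. curv (pole_sum a) 0)"
  proof -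
    have "pole_poly (pole_sum a) 0 \<noteq> 0" if "a \<in> {?l..?u}" for a
      using pole_poly_pos[OF pole_sum_gt, of a 0] that by simp
    then show ?thesis
      unfolding curv_def pole_poly_def pole_sum_def by (intro continuous_intros) auto
  qed
  then obtain a where a: "a \<in> {?l..?u}" "curv (pole_sum a) 0 = Polygamma 2 1"
    using IVT'[of "\<lambda>a. curv (pole_sum a) 0" ?l "Polygamma 2 1" ?u] Polygamma_2_1_between by auto
  moreover from a(2) have "a \<noteq> ?l" "a \<noteq> ?u" using Polygamma_2_1_between by (metis order_less_irrefl)+
  ultimately show ?thesis by (intro that[of a]) (auto simp: is_root_iff)
qed

lemma ex1_root: "\<exists>!a. is_root a"
  using root_exists root_unique by metis

lemma is_root_a0'': "is_root a0''"
  unfolding a0''_def using ex1_root by (rule theI')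

lemma a0''_bounds: "0.4321803644583304 < a0''" "a0'' < 0.4321803644583306"
  using root_exists root_unique[OF is_root_a0''] by metis+

section \<open>Convexity and monotonicity of the difference\<close>

definition F' :: "real \<Rightarrow> real \<Rightarrow> real" where
  "F' a x = Polygamma 1 (x + 1) - slope (pole_sum a) x"

definition F'' :: "real \<Rightarrow> real \<Rightarrow> real" where
  "F'' a x = Polygamma 2 (x + 1) - curv (pole_sum a) (x\<^sup>2 + x)"

lemma F_has_derivative:
  assumes "a > 1/15" "x \<ge> 0"
  shows "(F a has_real_derivative F' a x) (at x)"
proof -
  have "x\<^sup>2 + x + (15*a-1)/(45*a) > 0"
    using pole_shift_pos[OF assms(1)] assms(2) by (auto intro: add_nonneg_pos)
  from L_has_derivative[OF assms(1) this]
  show ?thesis unfolding F_def[abs_def] F'_def using assms(2)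
    by (auto intro!: derivative_eq_intros simp: nonpos_Ints_def)
qed

lemma F'_has_derivative:
  assumes "a > 1/15" "x \<ge> 0"
  shows "(F' a has_real_derivative F'' a x) (at x)"
proof -
  have "pole_poly (pole_sum a) (x\<^sup>2 + x) \<noteq> 0"
    using pole_poly_pos[OF pole_sum_gt[OF assms(1)], of "x\<^sup>2 + x"] assms(2) by simp
  from slope_has_derivative[OF this]
  show ?thesis unfolding F'_def[abs_def] F''_def using assms(2)
    by (auto intro!: derivative_eq_intros simp: numeral_2_eq_2)
qed

text \<open>By monotonicity in \<open>a\<close> only the extremal parameter \<open>a0''\<close> matters, for which the second derivative
  vanishes at \<open>0\<close>.\<close>

lemma F''_nonneg:
  assumes "1/15 < a" "a \<le> a0''" "x \<ge> 0"
  shows "F'' a x \<ge> 0"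
proof -
  have "curv (pole_sum a) (x\<^sup>2 + x) \<le> curv (pole_sum a0'') (x\<^sup>2 + x)"
    using curv_pole_sum_strict_mono[of a a0'' "x\<^sup>2 + x"] assms by (cases "a = a0''") auto
  also have "pole_sum 0.4321803644583304 < pole_sum a0''" "pole_sum a0'' < pole_sum 0.4321803644583306"
    using a0''_bounds by (intro pole_sum_mono; simp)+
  then have "pole_sum a0'' \<in> {10474/10000..10475/10000}" by (simp add: pole_sum_def)
  then have "curv (pole_sum a0'') (x\<^sup>2 + x) \<le> Polygamma 2 (x + 1)"
    using is_root_a0'' assms(3) unfolding is_root_iff by (intro curv_le_Polygamma_if_touching) auto
  finally show ?thesis by (simp add: F''_def)
qed

lemma convex_on_F:
  assumes "1/15 < a" "a \<le> a0''"
  shows "convex_on {0<..} (F a)"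
  by (rule f''_ge0_imp_convex[where f' = "F' a" and f'' = "F'' a"])
     (use assms F_has_derivative F'_has_derivative F''_nonneg in \<open>auto simp: less_imp_le\<close>)

text \<open>The derivative increases by convexity and tends to \<open>0\<close> along \<open>x, x + 1, x + 2, \<dots>\<close>, so it is nowhere
  positive.\<close>

lemma antimono_on_F:
  assumes a: "1/15 < a" "a \<le> a0''"
  shows "antimono_on {0<..} (F a)"
proof -
  have mono: "F' a x \<le> F' a y" if "0 \<le> x" "x \<le> y" for x y
  proof (rule DERIV_nonneg_imp_nondecreasing[OF that(2)])
    fix z assume "x \<le> z"
    then show "\<exists>d. (F' a has_real_derivative d) (at z) \<and> 0 \<le> d"
      using that F'_has_derivative[OF a(1), of z] F''_nonneg[OF a, of z] by fastforce
  qed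
  have nonpos: "F' a x \<le> 0" if "x \<ge> 0" for x
  proof -
    have "(\<lambda>n. Polygamma 1 ((x + 1) + real n)) \<longlonglongrightarrow> 0"
      using that by (intro Polygamma_add_nat_tendsto_zero) auto
    moreover have "(\<lambda>n. slope (pole_sum a) (x + real n)) \<longlonglongrightarrow> 0"
      by (rule filterlim_compose[OF slope_tendsto_zero shifted_at_top])
    ultimately have "(\<lambda>n. - F' a (x + real n)) \<longlonglongrightarrow> - (0 - 0)"
      unfolding F'_def by (intro tendsto_minus tendsto_diff) (simp_all add: add_ac)
    then have "- F' a x \<ge> 0"
      using that mono by (intro nonneg_if_antimono_tendsto_zero[where h = "\<lambda>x. - F' a x"]) auto
    then show ?thesis by simp
  qed
  show ?thesis
  proof (rule monotone_onI)
    fix x y :: real assume "x \<in> {0<..}" "y \<in> {0<..}" "x \<le> y"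
    show "F a y \<le> F a x"
    proof (rule DERIV_nonpos_imp_nonincreasing[OF \<open>x \<le> y\<close>])
      fix z assume "x \<le> z"
      then show "\<exists>d. (F a has_real_derivative d) (at z) \<and> d \<le> 0"
        using \<open>x \<in> {0<..}\<close> F_has_derivative[OF a(1), of z] nonpos[of z] by fastforce
    qed
  qed
qed

text \<open>Monotonicity in \<open>a\<close> makes the second derivative negative at \<open>0\<close>, hence, by continuity, on an interval
  to the right of \<open>0\<close>. There the derivative decreases strictly, while convexity would make it increase.\<close>

lemma not_convex_on_F:
  assumes a: "a0'' < a"
  shows "\<not> convex_on {0<..} (F a)"
proof
  assume convex: "convex_on {0<..} (F a)"
  have a1: "1/15 < a" using a a0''_bounds by simp
  have "F'' a 0 < 0"
    using curv_pole_sum_strict_mono[of a0'' a 0] is_root_a0'' a by (simp add: is_root_iff F''_def)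
  moreover have "isCont (F'' a) 0"
  proof -
    have "pole_poly (pole_sum a) 0 \<noteq> 0"
      using pole_poly_pos[OF pole_sum_gt[OF a1], of 0] by simp
    then show ?thesis
      unfolding F''_def[abs_def] curv_def pole_poly_def by (intro continuous_intros) auto
  qed
  ultimately have "\<forall>\<^sub>F x in nhds 0. F'' a x < 0"
    by (intro order_tendstoD) (simp_all add: isCont_def tendsto_nhds_iff)
  then obtain e where e: "e > 0" "\<And>x. \<bar>x\<bar> < e \<Longrightarrow> F'' a x < 0"
    unfolding eventually_nhds_metric by (auto simp: dist_real_def)
  define c d where "c = e/3" and "d = e/2"
  have cd: "0 < c" "c < d" "d < e" using e by (auto simp: c_def d_def)
  have above: "F a y - F a x \<ge> F' a x * (y - x)" if "x > 0" "y > 0" for x y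
    using convex_on_imp_above_tangent[OF convex, of x y "F' a x"]
      has_field_derivative_at_within[OF F_has_derivative[OF a1, of x]] that
    by (simp add: interior_open connected_Ioi)
  have "F' a c * (d - c) \<le> F' a d * (d - c)"
    using above[of c d] above[of d c] cd by (simp add: algebra_simps)
  then have "F' a c \<le> F' a d" using cd by simp
  moreover have "F' a d < F' a c"
  proof (rule DERIV_neg_imp_decreasing[OF cd(2)])
    fix z assume "c \<le> z" "z \<le> d"
    then show "\<exists>y. (F' a has_real_derivative y) (at z) \<and> y < 0"
      using cd e(2)[of z] F'_has_derivative[OF a1, of z] by fastforce
  qed
  ultimately show False by simp
qed

theorem corollary2:
  shows "(\<exists>!a. is_root a)
    \<and> \<bar>a0'' - 0.4321803644583305\<bar> < 1 / 10 ^ 16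
    \<and> (\<forall>a\<in>{1/15<..}.
         (antimono_on {0<..} (F a) \<and> convex_on {0<..} (F a)) \<longleftrightarrow> a \<in> {1/15<..a0''})"
proof (intro conjI ballI)
  show "\<exists>!a. is_root a" by (rule ex1_root)
  show "\<bar>a0'' - 0.4321803644583305\<bar> < 1 / 10 ^ 16"
    using a0''_bounds unfolding abs_less_iff by simp
  fix a :: real assume "a \<in> {1/15<..}"
  then show "(antimono_on {0<..} (F a) \<and> convex_on {0<..} (F a)) \<longleftrightarrow> a \<in> {1/15<..a0''}"
    using antimono_on_F convex_on_F not_convex_on_F by (force simp: not_le)
qed

end
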